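(* For all $a \in (0, \tfrac12)$ and $x \in (0,1)$ we have $$\widetilde L_a(x) < {}_3F_2\left( a+\tfrac12, a+\tfrac12, a+1; \tfrac32, a+\tfrac32 ; x^{\frac1a} \right) < \widetilde R_a(x),$$ where $$\widetilde L_a(x) = \frac12 + \frac{1+2a}{8a^2x^{\frac1{2a}}}\,\left( 1 - \frac{1+2a \log(1+x^{\frac1{2a}})}{(1+x^{\frac1{2a}})^{2a}} \right),$$ $$\widetilde R_a(x) = \frac{1+2a}{8a^2x^{\frac1{2a}}}\,\left(\frac{\pi_{1/(2a)}}2 - \frac{1+\frac{2a}{1+2a}\log(1+x^{\frac1{2a}})}{(1+x^{\frac1{2a}})^{2a}}\right),$$ and $\pi_p = \dfrac{2\pi}{p\, \sin(\pi/p)}$ for $p>1$.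
   Context: The generalized hypergeometric (Clausen) function is ${}_3F_2(a,b,c;d,e;z)=\sum_{n\ge0}\frac{(a,n)(b,n)(c,n)}{(d,n)(e,n)}\frac{z^n}{n!}$ for $|z|<1$, where $(a,n)=a(a+1)\cdots(a+n-1)$ (with $(a,0)=1$) is the rising factorial. *)

theory Defs
  imports "HOL-Analysis.Analysis"
begin

text \<open>
  The series converges for \<open>norm z < 1\<close> when neither \<open>d\<close> nor \<open>e\<close> is a nonpositive integer;
  the definition is only meant to be used there.
\<close>

definition hypergeo_3F2 ::
    "'a \<Rightarrow> 'a \<Rightarrow> 'a \<Rightarrow> 'a \<Rightarrow> 'a \<Rightarrow> 'a \<Rightarrow> 'a :: {real_normed_field, banach}" where
  "hypergeo_3F2 a b c d e z =
     (\<Sum>n. (pochhammer a n * pochhammer b n * pochhammer c n) /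
           (pochhammer d n * pochhammer e n) * (z ^ n / fact n))"

text \<open>The generalized constant \<open>\<pi>\<^sub>p\<close>, meant for \<open>p > 1\<close>.\<close>

definition gen_pi :: "real \<Rightarrow> real" where
  "gen_pi p = 2 * pi / (p * sin (pi / p))"

definition L_tilde :: "real \<Rightarrow> real \<Rightarrow> real" where
  "L_tilde a x =
     1 / 2 + (1 + 2 * a) / (8 * a\<^sup>2 * x powr (1 / (2 * a))) *
       (1 - (1 + 2 * a * ln (1 + x powr (1 / (2 * a)))) /
            (1 + x powr (1 / (2 * a))) powr (2 * a))"

definition R_tilde :: "real \<Rightarrow> real \<Rightarrow> real" where
  "R_tilde a x =
     (1 + 2 * a) / (8 * a\<^sup>2 * x powr (1 / (2 * a))) *
       (gen_pi (1 / (2 * a)) / 2 -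
        (1 + 2 * a / (1 + 2 * a) * ln (1 + x powr (1 / (2 * a)))) /
        (1 + x powr (1 / (2 * a))) powr (2 * a))"

end

theory Submission
  imports Defs
begin

text \<open>
  Put \<open>s = 2 * a\<close> and \<open>t = x powr (1 / (2 * a))\<close>, so that \<open>0 < s < 1\<close>, \<open>0 < t < 1\<close> and the argument
  of the hypergeometric function is \<open>t\<^sup>2\<close>.  By the duplication formula for rising factorials, the
  coefficients of \<open>3F2\<close> are, up to a constant factor, the odd-numbered coefficients of
  \<open>G z = (\<Sum>n. (s,n) / n! * s / (s + n) * z ^ n)\<close>, that is, of \<open>2F1(s, s; s + 1; z)\<close>; here
  \<open>(s,n)\<close> is \<open>pochhammer s n\<close>.  Hence
  \<open>2 * s\<^sup>2 * t / (1 + s) * 3F2 = G t - G (-t)\<close> (\<open>hypergeo_3F2_eq_odd_part\<close>), and both bounds come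
  from estimating the two terms on the right separately.

  The function \<open>G\<close> is an incomplete beta integral: \<open>G z * z powr s\<close> has derivative
  \<open>s * z powr (s - 1) * (1 - z) powr (-s)\<close>.

  For \<open>G t\<close>, all coefficients are positive.  The first two terms give \<open>1 + s\<^sup>2 / (1 + s) * t < G t\<close>.
  In the other direction \<open>G t\<close> is below the limit of \<open>G\<close> at 1, which is at most
  \<open>s * Beta s (1 - s) = pi * s / sin (pi * s)\<close>, the value of \<open>gen_pi (1 / s) / 2\<close>.

  For \<open>G (-t)\<close>, compare it with \<open>(1 + c * ln (1 + t)) * (1 + t) powr (-s)\<close>.  After multiplication by
  \<open>t powr s\<close> both sides vanish at 0, and the derivative of the difference is a positive
  multiple of \<open>(s - c) * t - s * c * ln (1 + t)\<close>.  This is negative for \<open>c = s\<close>.  For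
  \<open>c = s / (1 + s)\<close> it equals \<open>s * c * (t - ln (1 + t)) > 0\<close>.  These two values of \<open>c\<close> are exactly the
  ones that occur in \<open>L_tilde\<close> and \<open>R_tilde\<close>.
\<close>

section \<open>The incomplete beta series\<close>

text \<open>
  The coefficients of \<open>2F1(s, s; s + 1; z)\<close>: the quotient \<open>(s,n) / (s + 1,n)\<close> is written in its
  closed form \<open>s / (s + n)\<close>.
\<close>

definition beta_coeff :: "real \<Rightarrow> nat \<Rightarrow> real" where
  "beta_coeff s n = pochhammer s n / fact n * (s / (s + real n))"

definition beta_series :: "real \<Rightarrow> real \<Rightarrow> real" where
  "beta_series s z = (\<Sum>n. beta_coeff s n * z ^ n)"

lemma beta_coeff_pos:
  assumes "0 < s"
  shows "0 < beta_coeff s n"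
  using assms by (auto simp: beta_coeff_def intro!: mult_pos_pos divide_pos_pos pochhammer_pos)

lemma binomial_series_pochhammer:
  fixes s z :: real
  assumes "\<bar>z\<bar> < 1"
  shows "(\<lambda>n. pochhammer s n / fact n * z ^ n) sums (1 - z) powr (- s)"
proof -
  have "((- s) gchoose n) * (- z) ^ n = pochhammer s n / fact n * z ^ n" for n
  proof -
    have "(- 1) ^ n * (- z) ^ n = z ^ n"
      by (simp flip: power_mult_distrib)
    then show ?thesis
      by (simp add: gbinomial_pochhammer)
  qed
  with gen_binomial_real[of "- z" "- s"] assms show ?thesis
    by simp
qed

lemma summable_beta_series:
  assumes "0 < s" "\<bar>z\<bar> < 1"
  shows "summable (\<lambda>n. beta_coeff s n * z ^ n)"
proof (rule summable_comparison_test')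
  show "summable (\<lambda>n. pochhammer s n / fact n * \<bar>z\<bar> ^ n)"
    using binomial_series_pochhammer[of "\<bar>z\<bar>" s] assms by (simp add: sums_iff)
  show "norm (beta_coeff s n * z ^ n) \<le> pochhammer s n / fact n * \<bar>z\<bar> ^ n" if "0 \<le> n" for n
  proof -
    have le: "beta_coeff s n \<le> pochhammer s n / fact n * 1"
      unfolding beta_coeff_def using assms pochhammer_pos[of s n]
      by (intro mult_left_mono) auto
    have "norm (beta_coeff s n * z ^ n) = beta_coeff s n * \<bar>z\<bar> ^ n"
      using beta_coeff_pos[of s n] assms by (simp add: abs_mult power_abs)
    also have "\<dots> \<le> pochhammer s n / fact n * \<bar>z\<bar> ^ n"
      by (rule mult_right_mono) (use le in auto)
    finally show ?thesis .
  qed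
qed

lemma beta_series_has_derivative:
  assumes "0 < s" "\<bar>z\<bar> < 1"
  shows "(beta_series s has_real_derivative (\<Sum>n. diffs (beta_coeff s) n * z ^ n)) (at z)"
  unfolding beta_series_def[abs_def]
proof (rule termdiffs_strong')
  show "summable (\<lambda>n. beta_coeff s n * w ^ n)" if "norm w < 1" for w
    using that assms by (intro summable_beta_series) auto
qed (use assms in auto)

lemma isCont_beta_series:
  assumes "0 < s" "\<bar>z\<bar> < 1"
  shows "isCont (beta_series s) z"
  using beta_series_has_derivative[OF assms] by (rule DERIV_isCont)

text \<open>
  The operator \<open>f \<mapsto> s * f + z * f'\<close> multiplies the \<open>n\<close>-th coefficient by \<open>s + n\<close>; this cancels
  the denominators and leaves the binomial series.
\<close>

lemma beta_series_ode:
  assumes s: "0 < s" and z: "\<bar>z\<bar> < 1"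
  obtains D where "(beta_series s has_real_derivative D) (at z)"
    and "s * beta_series s z + z * D = s * (1 - z) powr (- s)"
proof
  define D where "D = (\<Sum>n. diffs (beta_coeff s) n * z ^ n)"
  show "(beta_series s has_real_derivative D) (at z)"
    unfolding D_def by (rule beta_series_has_derivative[OF assms])
  have "summable (\<lambda>n. diffs (beta_coeff s) n * z ^ n)"
    by (rule termdiff_converges[of z 1]) (use z summable_beta_series[OF s] in auto)
  then have "(\<lambda>n. real n * beta_coeff s n * z ^ (n - Suc 0)) sums D"
    unfolding D_def by (rule diffs_equiv)
  then have "(\<lambda>n. z * (real n * beta_coeff s n * z ^ (n - Suc 0))) sums (z * D)"
    by (rule sums_mult)
  also have "(\<lambda>n. z * (real n * beta_coeff s n * z ^ (n - Suc 0))) =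
      (\<lambda>n. real n * beta_coeff s n * z ^ n)"
  proof
    show "z * (real n * beta_coeff s n * z ^ (n - Suc 0)) = real n * beta_coeff s n * z ^ n" for n
      by (cases n) auto
  qed
  finally have "(\<lambda>n. real n * beta_coeff s n * z ^ n) sums (z * D)" .
  moreover have "(\<lambda>n. s * (beta_coeff s n * z ^ n)) sums (s * beta_series s z)"
    unfolding beta_series_def
    by (intro sums_mult summable_sums summable_beta_series assms)
  ultimately have "(\<lambda>n. s * (beta_coeff s n * z ^ n) + real n * beta_coeff s n * z ^ n) sums
      (s * beta_series s z + z * D)"
    by (intro sums_add)
  moreover have "s * (beta_coeff s n * z ^ n) + real n * beta_coeff s n * z ^ n =
      s * (pochhammer s n / fact n * z ^ n)" for n
  proof -
    have "(s + real n) * beta_coeff s n = s * (pochhammer s n / fact n)"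
      using s by (simp add: beta_coeff_def)
    then have "(s + real n) * beta_coeff s n * z ^ n = s * (pochhammer s n / fact n) * z ^ n"
      by simp
    then show ?thesis
      by (simp only: distrib_right mult.assoc)
  qed
  ultimately have "(\<lambda>n. s * (pochhammer s n / fact n * z ^ n)) sums
      (s * beta_series s z + z * D)"
    by simp
  moreover have "(\<lambda>n. s * (pochhammer s n / fact n * z ^ n)) sums (s * (1 - z) powr (- s))"
    by (intro sums_mult binomial_series_pochhammer z)
  ultimately show "s * beta_series s z + z * D = s * (1 - z) powr (- s)"
    by (rule sums_unique2)
qed

text \<open>
  The two signs are the two halves of the odd part: \<open>e = 1\<close> gives the incomplete beta integral,
  \<open>e = -1\<close> its analogue with \<open>1 + v\<close> in place of \<open>1 - v\<close>.
\<close>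

lemma powr_beta_series_has_derivative:
  assumes s: "0 < s" and v: "0 < v" "v < 1" and e: "\<bar>e\<bar> = 1"
  shows "((\<lambda>v. v powr s * beta_series s (e * v)) has_real_derivative
      s * v powr (s - 1) * (1 - e * v) powr (- s)) (at v)"
proof -
  have "\<bar>e * v\<bar> < 1"
    using v e by (simp add: abs_mult)
  then obtain D where D: "(beta_series s has_real_derivative D) (at (e * v))"
    and ode: "s * beta_series s (e * v) + e * v * D = s * (1 - e * v) powr (- s)"
    using beta_series_ode[OF s] by blast
  have "((\<lambda>v. beta_series s (e * v)) has_real_derivative D * e) (at v)"
    by (rule DERIV_chain2[where f = "beta_series s" and g = "\<lambda>v. e * v", OF D]) (auto intro!: derivative_eq_intros)
  moreover have "((\<lambda>v. v powr s) has_real_derivative s * v powr (s - 1)) (at v)"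
    by (rule has_real_derivative_powr[OF v(1)])
  ultimately have "((\<lambda>v. v powr s * beta_series s (e * v)) has_real_derivative
      s * v powr (s - 1) * beta_series s (e * v) + D * e * v powr s) (at v)"
    by (rule DERIV_mult[rotated])
  also have "s * v powr (s - 1) * beta_series s (e * v) + D * e * v powr s =
      v powr (s - 1) * (s * beta_series s (e * v) + e * v * D)"
    using v by (simp add: powr_diff field_simps)
  finally show ?thesis
    unfolding ode by (simp add: mult_ac)
qed

lemma continuous_on_powr_beta_series:
  assumes "0 < s" "t < 1" and e: "\<bar>e\<bar> = 1"
  shows "continuous_on {0..t} (\<lambda>v. v powr s * beta_series s (e * v))"
proof -
  have "isCont (\<lambda>v. beta_series s (e * v)) v" if "v \<in> {0..t}" for v
    by (rule isCont_o2[where g = "beta_series s"])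
       (use that assms in \<open>auto intro!: isCont_beta_series continuous_intros simp: abs_mult\<close>)
  then have "continuous_on {0..t} (\<lambda>v. beta_series s (e * v))"
    by (simp add: continuous_at_imp_continuous_on)
  then show ?thesis
    using assms by (intro continuous_intros continuous_on_powr') auto
qed

section \<open>Bounds at a positive argument\<close>

lemma beta_series_strict_mono:
  assumes s: "0 < s" and t: "0 \<le> t" "t < u" "u < 1"
  shows "beta_series s t < beta_series s u"
proof -
  have sum: "summable (\<lambda>n. beta_coeff s n * u ^ n)" "summable (\<lambda>n. beta_coeff s n * t ^ n)"
    using assms by (auto intro!: summable_beta_series)
  have "0 < (\<Sum>n. beta_coeff s n * u ^ n - beta_coeff s n * t ^ n)"
  proof (rule suminf_pos2[where i = 1])
    show "0 \<le> beta_coeff s n * u ^ n - beta_coeff s n * t ^ n" for n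
      using t beta_coeff_pos[OF s, of n] by (simp add: mult_left_mono power_mono)
    show "0 < beta_coeff s 1 * u ^ 1 - beta_coeff s 1 * t ^ 1"
      using t beta_coeff_pos[OF s, of 1] by simp
  qed (intro summable_diff sum)
  then show ?thesis
    by (simp add: beta_series_def suminf_diff[OF sum, symmetric])
qed

lemma beta_series_gt_linear:
  assumes s: "0 < s" and t: "0 < t" "t < 1"
  shows "1 + s\<^sup>2 / (1 + s) * t < beta_series s t"
proof -
  have "(\<Sum>n<2. beta_coeff s n * t ^ n) < beta_series s t"
    unfolding beta_series_def
    using assms by (intro sum_less_suminf summable_beta_series mult_pos_pos beta_coeff_pos) auto
  moreover have "beta_coeff s 0 = 1" "beta_coeff s 1 = s\<^sup>2 / (1 + s)"
    using s by (auto simp: beta_coeff_def power2_eq_square add.commute)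
  ultimately show ?thesis
    by (simp add: numeral_2_eq_2)
qed

lemma Beta_reflection:
  fixes s :: real
  shows "Beta s (1 - s) = pi / sin (pi * s)"
proof -
  have "complex_of_real (Gamma s * Gamma (1 - s)) = of_real (pi / sin (pi * s))"
    using Gamma_reflection_complex[of "of_real s"]
    by (simp flip: Gamma_complex_of_real sin_of_real)
  then have "Gamma s * Gamma (1 - s) = pi / sin (pi * s)"
    unfolding of_real_eq_iff .
  then show ?thesis
    by (simp add: Beta_def)
qed

text \<open>
  The left-hand side is the integral over \<open>{0..t}\<close> of a nonnegative function whose integral over
  \<open>{0..1}\<close> is the right-hand side.
\<close>

lemma powr_beta_series_le_Beta:
  assumes s: "0 < s" "s < 1" and t: "0 < t" "t < 1"
  shows "t powr s * beta_series s t \<le> s * Beta s (1 - s)"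
proof -
  let ?F = "\<lambda>v. v powr s * beta_series s (1 * v)"
  let ?f = "\<lambda>v. s * (v powr (s - 1) * (1 - v) powr (- s))"
  have "(?f has_integral (?F t - ?F 0)) {0..t}"
  proof (rule fundamental_theorem_of_calculus_interior)
    show "(?F has_vector_derivative ?f v) (at v)" if "v \<in> {0<..<t}" for v
      using powr_beta_series_has_derivative[of s v 1] that s t
      by (simp add: has_real_derivative_iff_has_vector_derivative mult.assoc)
    show "continuous_on {0..t} ?F"
      by (rule continuous_on_powr_beta_series) (use s t in auto)
  qed (use t in auto)
  then have "(?f has_integral (t powr s * beta_series s t)) {0..t}"
    by simp
  moreover have "(?f has_integral s * Beta s (1 - s)) {0..1}"
    using has_integral_mult_right[OF has_integral_Beta_real[of s "1 - s"], of s] s by simp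
  ultimately show ?thesis
    by (rule has_integral_subset_le[rotated]) (use s t in auto)
qed

text \<open>
  The preceding bound carries a factor \<open>t powr s < 1\<close> on the wrong side.  Applying it at points
  \<open>w\<close> that tend to 1 removes the factor; an intermediate point \<open>u\<close> keeps the inequality strict in
  the limit.
\<close>

lemma beta_series_less_Beta:
  assumes s: "0 < s" "s < 1" and t: "0 < t" "t < 1"
  shows "beta_series s t < s * Beta s (1 - s)"
proof -
  obtain u where u: "t < u" "u < 1"
    using dense[OF t(2)] by blast
  have bound: "w powr s * beta_series s u \<le> s * Beta s (1 - s)" if w: "u < w" "w < 1" for w
  proof -
    have "w powr s * beta_series s u \<le> w powr s * beta_series s w"
      using beta_series_strict_mono[of s u w] s t u w by (intro mult_left_mono) auto
    also have "\<dots> \<le> s * Beta s (1 - s)"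
      by (rule powr_beta_series_le_Beta) (use s t u w in auto)
    finally show ?thesis .
  qed
  have "((\<lambda>w. w powr s * beta_series s u) \<longlongrightarrow> 1 powr s * beta_series s u) (at_left 1)"
    by (intro tendsto_intros) auto
  moreover have "eventually (\<lambda>w. w powr s * beta_series s u \<le> s * Beta s (1 - s)) (at_left 1)"
    using eventually_at_left_real[OF u(2)] by eventually_elim (use bound in auto)
  ultimately have "1 powr s * beta_series s u \<le> s * Beta s (1 - s)"
    by (rule tendsto_upperbound) auto
  then show ?thesis
    using beta_series_strict_mono[of s t u] s t u by simp
qed

section \<open>Bounds at a negative argument\<close>

text \<open>
  With \<open>K v\<close> the difference of the two sides of a comparison
  \<open>G (-v) \<approx> (1 + c * ln (1 + v)) * (1 + v) powr (-s)\<close>, the weighted difference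
  \<open>v powr s * K v\<close> starts at 0, so its sign is decided by the sign of its derivative.
\<close>

lemma log_comparison_has_derivative:
  assumes s: "0 < s" and v: "0 < v" "v < 1"
  shows "((\<lambda>v. v powr s * beta_series s (- v) - v powr s * (1 + v) powr (- s) * (1 + c * ln (1 + v)))
      has_real_derivative
        v powr (s - 1) * (1 + v) powr (- s - 1) * ((s - c) * v - s * c * ln (1 + v))) (at v)"
proof -
  let ?A = "v powr (s - 1)" and ?B = "(1 + v) powr (- s - 1)" and ?l = "ln (1 + v)"
  have As: "v powr s = ?A * v" and Bs: "(1 + v) powr (- s) = ?B * (1 + v)"
    using v by (simp_all add: powr_diff)
  have "((\<lambda>v. v powr s * beta_series s (- v)) has_real_derivative
      s * ?A * (1 + v) powr (- s)) (at v)"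
    using powr_beta_series_has_derivative[OF s v, of "-1"] by simp
  moreover have "((\<lambda>v. v powr s * (1 + v) powr (- s) * (1 + c * ln (1 + v))) has_real_derivative
      (s * ?A * (1 + v) powr (- s) + v powr s * (- s * ?B)) * (1 + c * ?l) +
      v powr s * (1 + v) powr (- s) * (c / (1 + v))) (at v)"
    using v by (auto intro!: derivative_eq_intros) (simp add: algebra_simps)
  ultimately have "((\<lambda>v. v powr s * beta_series s (- v) -
      v powr s * (1 + v) powr (- s) * (1 + c * ln (1 + v))) has_real_derivative
      s * ?A * (1 + v) powr (- s) -
      ((s * ?A * (1 + v) powr (- s) + v powr s * (- s * ?B)) * (1 + c * ?l) +
       v powr s * (1 + v) powr (- s) * (c / (1 + v)))) (at v)"
    by (rule DERIV_diff)
  also have "s * ?A * (1 + v) powr (- s) -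
      ((s * ?A * (1 + v) powr (- s) + v powr s * (- s * ?B)) * (1 + c * ?l) +
       v powr s * (1 + v) powr (- s) * (c / (1 + v))) =
      ?A * ?B * ((s - c) * v - s * c * ?l)"
  proof -
    have "?A * v * (?B * (1 + v)) * (c / (1 + v)) = ?A * ?B * (v * c)"
      using v by simp
    then show ?thesis
      unfolding As Bs by (simp add: algebra_simps)
  qed
  finally show ?thesis .
qed

lemma continuous_on_log_comparison:
  assumes "0 < s" "t < 1"
  shows "continuous_on {0..t}
    (\<lambda>v. v powr s * beta_series s (- v) - v powr s * (1 + v) powr (- s) * (1 + c * ln (1 + v)))"
proof (rule continuous_on_diff)
  show "continuous_on {0..t} (\<lambda>v. v powr s * beta_series s (- v))"
    using continuous_on_powr_beta_series[OF assms, of "-1"] by simp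
  show "continuous_on {0..t} (\<lambda>v. v powr s * (1 + v) powr (- s) * (1 + c * ln (1 + v)))"
    using assms by (intro continuous_intros continuous_on_powr') auto
qed

lemma beta_series_neg_upper:
  assumes s: "0 < s" and t: "0 < t" "t < 1"
  shows "beta_series s (- t) < (1 + s * ln (1 + t)) / (1 + t) powr s"
proof -
  let ?H = "\<lambda>v. v powr s * beta_series s (- v) -
    v powr s * (1 + v) powr (- s) * (1 + s * ln (1 + v))"
  have "?H t < ?H 0"
  proof (rule DERIV_neg_imp_decreasing_open[OF t(1)])
    fix v assume v: "0 < v" "v < t"
    have "v powr (s - 1) * (1 + v) powr (- s - 1) * ((s - s) * v - s * s * ln (1 + v)) < 0"
      using v s by (intro mult_pos_neg) auto
    then show "\<exists>y. (?H has_real_derivative y) (at v) \<and> y < 0"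
      using log_comparison_has_derivative[of s v s] s t v by fastforce
  qed (intro continuous_on_log_comparison s t)
  then have "t powr s * (beta_series s (- t) - (1 + t) powr (- s) * (1 + s * ln (1 + t))) < 0"
    using t by (simp add: algebra_simps)
  then have "beta_series s (- t) - (1 + t) powr (- s) * (1 + s * ln (1 + t)) < 0"
    using t by (simp add: mult_less_0_iff)
  then show ?thesis
    by (simp add: powr_minus divide_inverse mult.commute)
qed

lemma beta_series_neg_lower:
  assumes s: "0 < s" and t: "0 < t" "t < 1"
  shows "(1 + s / (1 + s) * ln (1 + t)) / (1 + t) powr s < beta_series s (- t)"
proof -
  define c where "c = s / (1 + s)"
  have c: "0 < c" "s - c = s * c"
    using s by (simp_all add: c_def field_simps)
  let ?H = "\<lambda>v. v powr s * beta_series s (- v) -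
    v powr s * (1 + v) powr (- s) * (1 + c * ln (1 + v))"
  have "?H 0 < ?H t"
  proof (rule DERIV_pos_imp_increasing_open[OF t(1)])
    fix v assume v: "0 < v" "v < t"
    have "(s - c) * v - s * c * ln (1 + v) = s * c * (v - ln (1 + v))"
      unfolding c(2) by (simp add: algebra_simps)
    moreover have "ln (1 + v) < v"
      using v by (intro ln_add_one_self_less_self) auto
    ultimately have
      "0 < v powr (s - 1) * (1 + v) powr (- s - 1) * ((s - c) * v - s * c * ln (1 + v))"
      using v s c(1) by (auto intro!: mult_pos_pos)
    then show "\<exists>y. (?H has_real_derivative y) (at v) \<and> 0 < y"
      using log_comparison_has_derivative[of s v c] s t v by fastforce
  qed (intro continuous_on_log_comparison s t)
  then have "0 < t powr s * (beta_series s (- t) - (1 + t) powr (- s) * (1 + c * ln (1 + t)))"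
    using t by (simp add: algebra_simps)
  then have "0 < beta_series s (- t) - (1 + t) powr (- s) * (1 + c * ln (1 + t))"
    using t by (simp add: zero_less_mult_iff)
  then show ?thesis
    by (simp add: c_def powr_minus divide_inverse mult.commute)
qed

section \<open>The hypergeometric series as an odd part\<close>

text \<open>
  The duplication formula, applied to \<open>(1 + 2a, 2n)\<close> and to \<open>(2, 2n) = (2n + 1)!\<close>, merges the
  parameters in pairs; \<open>(a + 1/2, n) / (a + 3/2, n)\<close> telescopes to the factor
  \<open>(1 + 2a) / (1 + 2a + 2n)\<close>.
\<close>

lemma hypergeo_3F2_coeff:
  fixes a :: real
  assumes a: "0 < a"
  shows "pochhammer (a + 1/2) n * pochhammer (a + 1/2) n * pochhammer (a + 1) n /
      (pochhammer (3/2) n * pochhammer (a + 3/2) n) / fact n =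
    (1 + 2 * a) / (2 * a)\<^sup>2 * beta_coeff (2 * a) (2 * n + 1)"
proof -
  define P where "P = pochhammer (a + 1/2) n"
  define Q where "Q = pochhammer (a + 1) n"
  define R where "R = pochhammer (3/2 :: real) n"
  define S where "S = pochhammer (a + 3/2) n"
  define f where "f = (fact n :: real)"
  define k where "k = (2 ^ (2 * n) :: real)"
  have pos: "P > 0" "Q > 0" "R > 0" "S > 0" "f > 0" "k > 0"
    using a by (auto simp: P_def Q_def R_def S_def f_def k_def intro!: pochhammer_pos)
  have num: "pochhammer (2 * a) (2 * n + 1) = 2 * a * (k * P * Q)"
    using pochhammer_double[of "a + 1/2" n]
    by (simp add: pochhammer_rec P_def Q_def k_def algebra_simps)
  have den: "(fact (2 * n + 1) :: real) = k * f * R"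
  proof -
    have "(fact (2 * n + 1) :: real) = pochhammer 2 (2 * n)"
      by (simp only: pochhammer_fact Suc_eq_plus1[symmetric] pochhammer_rec) simp
    then show ?thesis
      using pochhammer_double[of "1 :: real" n]
      by (simp add: pochhammer_fact[of n] R_def k_def f_def del: fact_Suc)
  qed
  have PS: "(a + 1/2) * S = (a + 1/2 + real n) * P"
    using pochhammer_rec[of "a + 1/2" n] pochhammer_rec'[of "a + 1/2" n]
    by (simp add: P_def S_def add.commute)
  have ratio: "P / S = (1 + 2 * a) / (1 + 2 * a + 2 * real n)"
  proof (subst frac_eq_eq)
    show "P * (1 + 2 * a + 2 * real n) = (1 + 2 * a) * S"
      using PS by (simp add: algebra_simps)
  qed (use pos a in auto)
  have "P * P * Q / (R * S) / f = P * Q / (R * f) * (P / S)"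
    by (simp add: mult_ac)
  also have "\<dots> = P * Q / (R * f) * ((1 + 2 * a) / (1 + 2 * a + 2 * real n))"
    unfolding ratio ..
  also have "\<dots> = (1 + 2 * a) / (2 * a)\<^sup>2 *
      (2 * a * (k * P * Q) / (k * f * R) * (2 * a / (2 * a + real (2 * n + 1))))"
    using pos a by (simp add: power2_eq_square add_ac) (simp add: mult.commute)
  finally show ?thesis
    unfolding beta_coeff_def num den by (simp add: P_def Q_def R_def S_def f_def)
qed

lemma beta_series_odd_part:
  assumes s: "0 < s" and t: "\<bar>t\<bar> < 1"
  shows "(\<lambda>n. beta_coeff s (2 * n + 1) * t ^ (2 * n + 1)) sums
    ((beta_series s t - beta_series s (- t)) / 2)"
proof -
  let ?g = "\<lambda>n. (beta_coeff s n * t ^ n - beta_coeff s n * (- t) ^ n) / 2"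
  have "?g sums ((beta_series s t - beta_series s (- t)) / 2)"
    unfolding beta_series_def
    using s t by (intro sums_divide sums_diff summable_sums summable_beta_series) auto
  moreover have "?g n = 0" if "n \<notin> range (\<lambda>n. 2 * n + 1)" for n
  proof -
    have "even n"
      using that by (metis oddE rangeI)
    then show ?thesis by simp
  qed
  ultimately have "(\<lambda>n. ?g (2 * n + 1)) sums ((beta_series s t - beta_series s (- t)) / 2)"
    by (subst sums_mono_reindex) (auto simp: strict_mono_def)
  then show ?thesis
    by (simp add: mult_ac)
qed

lemma hypergeo_3F2_eq_odd_part:
  fixes a t :: real
  assumes a: "0 < a" and t: "0 < t" "t < 1"
  shows "hypergeo_3F2 (a + 1/2) (a + 1/2) (a + 1) (3/2) (a + 3/2) (t\<^sup>2) =
    (1 + 2 * a) / (8 * a\<^sup>2 * t) * (beta_series (2 * a) t - beta_series (2 * a) (- t))"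
proof -
  let ?C = "(1 + 2 * a) / ((2 * a)\<^sup>2 * t)"
  have term_eq: "pochhammer (a + 1/2) n * pochhammer (a + 1/2) n * pochhammer (a + 1) n /
        (pochhammer (3/2) n * pochhammer (a + 3/2) n) * ((t\<^sup>2) ^ n / fact n) =
      ?C * (beta_coeff (2 * a) (2 * n + 1) * t ^ (2 * n + 1))" (is "?X * (_ / _) = _") for n
  proof -
    have "?X * ((t\<^sup>2) ^ n / fact n) = ?X / fact n * t ^ (2 * n)"
      by (simp add: power_mult)
    also have "\<dots> = (1 + 2 * a) / (2 * a)\<^sup>2 * beta_coeff (2 * a) (2 * n + 1) * t ^ (2 * n)"
      unfolding hypergeo_3F2_coeff[OF a] ..
    also have "\<dots> = ?C * (beta_coeff (2 * a) (2 * n + 1) * t ^ (2 * n + 1))"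
      using t by simp
    finally show ?thesis .
  qed
  have "(\<lambda>n. ?C * (beta_coeff (2 * a) (2 * n + 1) * t ^ (2 * n + 1))) sums
      (?C * ((beta_series (2 * a) t - beta_series (2 * a) (- t)) / 2))"
    by (intro sums_mult beta_series_odd_part) (use a t in auto)
  then have "hypergeo_3F2 (a + 1/2) (a + 1/2) (a + 1) (3/2) (a + 3/2) (t\<^sup>2) =
      ?C * ((beta_series (2 * a) t - beta_series (2 * a) (- t)) / 2)"
    unfolding hypergeo_3F2_def term_eq by (rule sums_unique[symmetric])
  then show ?thesis
    by (simp add: power_mult_distrib)
qed

section \<open>The two-sided bound\<close>

theorem theorem8:
  fixes a x :: real
  assumes "a \<in> {0<..<1/2}" and "x \<in> {0<..<1}"
  shows "L_tilde a x < hypergeo_3F2 (a + 1/2) (a + 1/2) (a + 1) (3/2) (a + 3/2) (x powr (1 / a))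
       \<and> hypergeo_3F2 (a + 1/2) (a + 1/2) (a + 1) (3/2) (a + 3/2) (x powr (1 / a)) < R_tilde a x"
proof -
  define s where "s = 2 * a"
  define t where "t = x powr (1 / (2 * a))"
  define C where "C = (1 + 2 * a) / (8 * a\<^sup>2 * t)"
  define l where "l = (1 + s * ln (1 + t)) / (1 + t) powr s"
  define r where "r = (1 + s / (1 + s) * ln (1 + t)) / (1 + t) powr s"
  let ?G = "beta_series s"
  have a: "0 < a" and s: "0 < s" "s < 1"
    using assms by (auto simp: s_def)
  have t: "0 < t" "t < 1"
    using assms powr_less_mono2[of "1 / (2 * a)" x 1] by (auto simp: t_def)
  have C: "0 < C"
    using a t by (simp add: C_def)
  have arg: "x powr (1 / a) = t\<^sup>2"
    using a by (simp add: t_def power2_eq_square flip: powr_add)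
  have F: "hypergeo_3F2 (a + 1/2) (a + 1/2) (a + 1) (3/2) (a + 3/2) (x powr (1 / a)) =
      C * (?G t - ?G (- t))"
    unfolding arg C_def s_def by (rule hypergeo_3F2_eq_odd_part[OF a t])
  have half: "C * (s\<^sup>2 / (1 + s) * t) = 1 / 2"
    using a t by (simp add: C_def s_def power2_eq_square divide_simps)
  have "L_tilde a x = 1 / 2 + C * (1 - l)"
    by (simp add: L_tilde_def C_def l_def s_def flip: t_def)
  also have "\<dots> = C * (1 + s\<^sup>2 / (1 + s) * t - l)"
    by (simp add: half[symmetric] algebra_simps)
  also have "\<dots> < C * (?G t - ?G (- t))"
    using C beta_series_gt_linear[OF s(1) t] beta_series_neg_upper[OF s(1) t]
    unfolding l_def by (intro mult_strict_left_mono) auto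
  finally have lower: "L_tilde a x < C * (?G t - ?G (- t))" .
  have "gen_pi (1 / (2 * a)) / 2 = s * Beta s (1 - s)"
    unfolding Beta_reflection by (simp add: gen_pi_def s_def)
  then have R: "R_tilde a x = C * (s * Beta s (1 - s) - r)"
    by (simp add: R_tilde_def C_def r_def s_def flip: t_def)
  have "C * (?G t - ?G (- t)) < R_tilde a x"
    unfolding R using C beta_series_less_Beta[OF s t] beta_series_neg_lower[OF s(1) t]
    unfolding r_def by (intro mult_strict_left_mono) auto
  with lower show ?thesis
    unfolding F by blast
qed

end
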